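(* Let $t<k$ be positive integers and let $2\le v_1\le v_2\le\cdots\le v_k$ be integers. Then $(\bar{1},t)\text{-LAN}(k,(v_1,\dots,v_k))$ is at least: 1. $\prod_{i=k-t+1}^{k} v_i$, if $2v_{k-t}\le v_{k-t+1}$; 2. $\left\lceil \dfrac{2\sum_{i\le j_1<\cdots<j_t\le k}\prod_{s=1}^{t} v_{j_s}}{1+\binom{k-i+1}{t}}\right\rceil$, if $v_i=v_{i+1}=\cdots=v_{k-t}=v_{k-t+1}$ for some $i\in\{1,2,\dots,k-t\}$; 3. $\max\left\{\left\lceil \dfrac{2\sum_{k-t\le j_1<\cdots<j_t\le k}\prod_{s=1}^{t} v_{j_s}}{t+2}\right\rceil,\ \prod_{i=k-t+1}^{k} v_i+\prod_{i=k-t+2}^{k} v_i\right\}$, if $v_{k-t}<v_{k-t+1}<2v_{k-t}$ and $t\ge 2$; 4. $\left\lceil \dfrac{2v_{k-1}+2v_k}{3}\right\rceil$, if $v_{k-t}<v_{k-t+1}<2v_{k-t}$ and $t=1$.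
   Context: Let $k,t,N$ be positive integers with $t<k$. For positive integers $v_1,\dots,v_k$, consider $N\times k$ arrays $A=(a_{rj})$ whose $j$-th column has entries from a fixed set $V_j$ with $|V_j|=v_j$. A $t$-way interaction is a set $T=\{(j,\sigma_j): j\in I\}$ with $I\subseteq\{1,\dots,k\}$, $|I|=t$, $\sigma_j\in V_j$. Let $\rho(A,T)$ be the set of row indices $r$ with $a_{rj}=\sigma_j$ for all $j\in I$, and for a set $\mathcal T$ of $t$-way interactions let $\rho(A,\mathcal T)=\bigcup_{T\in\mathcal T}\rho(A,T)$. $A$ is a $(\bar 1,t)$-locating array, written $(\bar1,t)$-LA$(N;k,(v_1,\dots,v_k))$, if for all sets $\mathcal T_1,\mathcal T_2$ of $t$-way interactions with $|\mathcal T_1|\le1$, $|\mathcal T_2|\le1$ one has $\rho(A,\mathcal T_1)=\rho(A,\mathcal T_2)\iff \mathcal T_1=\mathcal T_2$ (equivalently: every $t$-way interaction occurs in at least one row, and distinct $t$-way interactions $T_1\neq T_2$ satisfy $\rho(A,T_1)\ne\rho(A,T_2)$). $(\bar1,t)$-LAN$(k,(v_1,\dots,v_k))$ denotes the minimum $N$ for which a $(\bar1,t)$-LA$(N;k,(v_1,\dots,v_k))$ exists. *)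

theory Defs
  imports Complex_Main
begin

text \<open>
  Rows are numbered 1..N and columns 1..k. The alphabet of column j is an arbitrary set \<open>V j\<close>;
  values of an array, or of \<open>V\<close>, outside these index ranges are irrelevant.
\<close>

definition interactions :: "nat \<Rightarrow> nat \<Rightarrow> (nat \<Rightarrow> 'a set) \<Rightarrow> (nat \<times> 'a) set set" where
  "interactions t k V =
     {{(j, \<sigma> j) | j. j \<in> I} | I \<sigma>. I \<subseteq> {1..k} \<and> card I = t \<and> (\<forall>j\<in>I. \<sigma> j \<in> V j)}"

definition rho :: "nat \<Rightarrow> (nat \<Rightarrow> nat \<Rightarrow> 'a) \<Rightarrow> (nat \<times> 'a) set \<Rightarrow> nat set" where
  "rho N A T = {r \<in> {1..N}. \<forall>(j, s) \<in> T. A r j = s}"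

definition rho_set :: "nat \<Rightarrow> (nat \<Rightarrow> nat \<Rightarrow> 'a) \<Rightarrow> (nat \<times> 'a) set set \<Rightarrow> nat set" where
  "rho_set N A \<T> = (\<Union>T\<in>\<T>. rho N A T)"

definition is_array :: "nat \<Rightarrow> nat \<Rightarrow> (nat \<Rightarrow> 'a set) \<Rightarrow> (nat \<Rightarrow> nat \<Rightarrow> 'a) \<Rightarrow> bool" where
  "is_array N k V A \<longleftrightarrow> (\<forall>r\<in>{1..N}. \<forall>j\<in>{1..k}. A r j \<in> V j)"

text \<open>
  The first index of a (1-bar, t)-locating array says that sets of at most one
  interaction are located. The empty set is included, so every interaction occurs in some row.
\<close>

definition locating_array ::
  "nat \<Rightarrow> nat \<Rightarrow> nat \<Rightarrow> (nat \<Rightarrow> 'a set) \<Rightarrow> (nat \<Rightarrow> nat \<Rightarrow> 'a) \<Rightarrow> bool" where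
  "locating_array t N k V A \<longleftrightarrow>
     is_array N k V A \<and>
     (\<forall>\<T>1 \<T>2. \<T>1 \<subseteq> interactions t k V \<and> finite \<T>1 \<and> card \<T>1 \<le> 1 \<and>
              \<T>2 \<subseteq> interactions t k V \<and> finite \<T>2 \<and> card \<T>2 \<le> 1 \<longrightarrow>
              (rho_set N A \<T>1 = rho_set N A \<T>2 \<longleftrightarrow> \<T>1 = \<T>2))"

text \<open>
  The locating array number, taken over arrays with the given alphabets \<open>V\<close>. Renaming symbols
  shows that it depends only on the sizes \<open>card (V j)\<close>. It is meaningful when all alphabets are
  finite with at least two symbols and \<open>0 < t < k\<close>: the array listing all \<open>k\<close>-tuples is then
  locating, so the minimum exists.
\<close>

definition LAN :: "nat \<Rightarrow> nat \<Rightarrow> (nat \<Rightarrow> 'a set) \<Rightarrow> nat" where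
  "LAN t k V = (LEAST N. N > 0 \<and> (\<exists>A. locating_array t N k V A))"

end

theory Submission
  imports Defs "HOL-Library.FuncSet"
begin

text \<open>
  In a locating array the row sets of the interactions are nonempty and pairwise distinct, so at
  most \<open>N\<close> of them are singletons and all others have at least two rows. Counting incidences
  between a family \<open>X\<close> of interactions and a set \<open>R\<close> of rows, each of which contains at most \<open>c\<close>
  members of \<open>X\<close>, gives \<open>2 |X| - |R| \<le> c |R|\<close>. Taking for \<open>X\<close> all interactions on the columns
  \<open>i..k\<close> yields the bounds with a ceiling. For the product bound in the third case, fix the symbols
  in the last \<open>t - 1\<close> columns and let \<open>X\<close> consist of the \<open>a + b\<close> interactions extending this choice
  by column \<open>k - t\<close> or \<open>k - t + 1\<close>, where \<open>a\<close> and \<open>b\<close> are the alphabet sizes; the \<open>n\<close> rows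
  containing the choice satisfy \<open>3 n \<ge> 2 (a + b) > 3 b\<close>.
\<close>

section \<open>Incidence counting for distinct nonempty sets\<close>

text \<open>The set \<open>R\<close> is kept abstract because two choices are used: all rows of the
  array, and only the rows containing a fixed choice of symbols.\<close>

lemma double_count_distinct_nonempty:
  fixes f :: "'x \<Rightarrow> 'r set"
  assumes "finite X" and "finite R" and inj: "inj_on f X"
    and sub: "\<And>x. x \<in> X \<Longrightarrow> f x \<subseteq> R" and ne: "\<And>x. x \<in> X \<Longrightarrow> f x \<noteq> {}"
    and deg: "\<And>r. r \<in> R \<Longrightarrow> card {x \<in> X. r \<in> f x} \<le> c"
  shows "2 * card X \<le> (1 + c) * card R"
proof -
  define S where "S = {x \<in> X. card (f x) = 1}"
  have "f ` S \<subseteq> (\<lambda>r. {r}) ` R"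
  proof
    fix B assume "B \<in> f ` S"
    then obtain x where x: "x \<in> X" "card (f x) = 1" "B = f x" by (auto simp: S_def)
    then obtain r where "f x = {r}" by (auto simp: card_1_singleton_iff)
    with sub[OF x(1)] x(3) show "B \<in> (\<lambda>r. {r}) ` R" by auto
  qed
  then have "card (f ` S) \<le> card R"
    using \<open>finite R\<close> by (meson card_image_le card_mono finite_imageI le_trans)
  moreover have "card (f ` S) = card S"
    using inj by (intro card_image) (auto simp: S_def inj_on_def)
  ultimately have S: "card S \<le> card R" by simp
  have "(\<Sum>x\<in>X. card (f x)) = (\<Sum>x\<in>X. \<Sum>r | r \<in> R \<and> r \<in> f x. 1)"
  proof (rule sum.cong[OF refl])
    fix x assume "x \<in> X"
    then have "{r. r \<in> R \<and> r \<in> f x} = f x" using sub by auto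
    then show "card (f x) = (\<Sum>r | r \<in> R \<and> r \<in> f x. 1)" by simp
  qed
  also have "\<dots> = (\<Sum>r\<in>R. \<Sum>x | x \<in> X \<and> r \<in> f x. 1)"
    by (rule sum.swap_restrict[OF \<open>finite X\<close> \<open>finite R\<close>])
  also have "\<dots> \<le> (\<Sum>r\<in>R. c)"
    using deg by (intro sum_mono) simp
  finally have incid: "(\<Sum>x\<in>X. card (f x)) \<le> c * card R" by (simp add: mult.commute)
  have "2 * card X = (\<Sum>x\<in>X. 2)" by simp
  \<comment> \<open>The correction term lifts a singleton to weight 2; the corrections add up to
    \<open>card S\<close>.\<close>
  also have "\<dots> \<le> (\<Sum>x\<in>X. card (f x) + (if card (f x) = 1 then 1 else 0))"
  proof (rule sum_mono)
    fix x assume x: "x \<in> X"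
    have "card (f x) \<noteq> 0"
      using sub[OF x] ne[OF x] \<open>finite R\<close> finite_subset by fastforce
    then show "2 \<le> card (f x) + (if card (f x) = 1 then 1 else 0)" by auto
  qed
  also have "\<dots> = (\<Sum>x\<in>X. card (f x)) + card S"
    using \<open>finite X\<close> by (simp add: sum.distrib S_def sum.If_cases Int_def)
  finally show ?thesis using incid S by simp
qed

section \<open>Interactions and the locating property in terms of row sets\<close>

text \<open>This is the graph of \<open>\<sigma>\<close> restricted to \<open>J\<close>. Values off
  \<open>J\<close> are lost, so functions in \<open>PiE J V\<close> serve as unique representatives
  in the counts below.\<close>

definition interaction :: "nat set \<Rightarrow> (nat \<Rightarrow> 'a) \<Rightarrow> (nat \<times> 'a) set" where
  "interaction J \<sigma> = (\<lambda>j. (j, \<sigma> j)) ` J"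

lemma interactionI:
  assumes "J \<subseteq> {1..k}" and "card J = t" and "\<And>j. j \<in> J \<Longrightarrow> \<sigma> j \<in> V j"
  shows "interaction J \<sigma> \<in> interactions t k V"
  using assms unfolding interactions_def interaction_def Setcompr_eq_image by blast

lemma interactionE:
  assumes "T \<in> interactions t k V"
  obtains J \<sigma> where "T = interaction J \<sigma>" "J \<subseteq> {1..k}" "card J = t" "\<And>j. j \<in> J \<Longrightarrow> \<sigma> j \<in> V j"
  using assms unfolding interactions_def interaction_def Setcompr_eq_image by blast

lemma interaction_eq_iff:
  "interaction J \<sigma> = interaction K \<tau> \<longleftrightarrow> J = K \<and> (\<forall>j\<in>J. \<sigma> j = \<tau> j)"
  unfolding interaction_def by auto

lemma rho_interaction:
  "rho N A (interaction J \<sigma>) = {r \<in> {1..N}. \<forall>j\<in>J. A r j = \<sigma> j}"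
  by (auto simp: rho_def interaction_def)

text \<open>Comparing \<open>{T}\<close> with the empty set gives nonemptiness, comparing
  \<open>{T}\<close> with \<open>{T'}\<close> gives injectivity; sets of at most one interaction
  admit no other comparisons of interest.\<close>

lemma locating_array_iff:
  "locating_array t N k V A \<longleftrightarrow>
     is_array N k V A \<and> (\<forall>T\<in>interactions t k V. rho N A T \<noteq> {}) \<and>
     inj_on (rho N A) (interactions t k V)"  (is "_ \<longleftrightarrow> ?R")
proof
  assume L: "locating_array t N k V A"
  have loc: "rho_set N A \<T>1 = rho_set N A \<T>2 \<longleftrightarrow> \<T>1 = \<T>2"
    if "\<T>1 \<subseteq> interactions t k V" "finite \<T>1" "card \<T>1 \<le> 1"
      "\<T>2 \<subseteq> interactions t k V" "finite \<T>2" "card \<T>2 \<le> 1" for \<T>1 \<T>2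
    using L that unfolding locating_array_def by blast
  have "rho N A T \<noteq> {}" if "T \<in> interactions t k V" for T
    using loc[of "{T}" "{}"] that by (simp add: rho_set_def)
  moreover have "T = T'"
    if "T \<in> interactions t k V" "T' \<in> interactions t k V" "rho N A T = rho N A T'" for T T'
    using loc[of "{T}" "{T'}"] that by (simp add: rho_set_def)
  ultimately show ?R using L unfolding locating_array_def inj_on_def by blast
next
  assume R: ?R
  have "rho_set N A \<T>1 = rho_set N A \<T>2 \<longleftrightarrow> \<T>1 = \<T>2"
    if sub: "\<T>1 \<subseteq> interactions t k V" "\<T>2 \<subseteq> interactions t k V"
      and small: "finite \<T>1" "card \<T>1 \<le> 1" "finite \<T>2" "card \<T>2 \<le> 1" for \<T>1 \<T>2
  proof -
    have "\<T>1 = {} \<or> (\<exists>T. \<T>1 = {T})" "\<T>2 = {} \<or> (\<exists>T. \<T>2 = {T})"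
      using small by (auto simp: le_Suc_eq card_1_singleton_iff)
    then consider "\<T>1 = {}" "\<T>2 = {}" | T where "\<T>1 = {T}" "\<T>2 = {}"
      | T where "\<T>1 = {}" "\<T>2 = {T}" | T T' where "\<T>1 = {T}" "\<T>2 = {T'}"
      by blast
    then show ?thesis
    proof cases
      case 4
      then have "rho N A T = rho N A T' \<longleftrightarrow> T = T'"
        using R sub by (intro inj_on_eq_iff) auto
      with 4 show ?thesis by (simp add: rho_set_def)
    qed (use R sub in \<open>fastforce simp: rho_set_def\<close>)+
  qed
  with R show "locating_array t N k V A" unfolding locating_array_def by blast
qed

lemma rho_nonempty:
  "locating_array t N k V A \<Longrightarrow> T \<in> interactions t k V \<Longrightarrow> rho N A T \<noteq> {}"
  by (simp add: locating_array_iff)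

lemma inj_rho: "locating_array t N k V A \<Longrightarrow> inj_on (rho N A) (interactions t k V)"
  by (simp add: locating_array_iff)

section \<open>Existence of a locating array\<close>

text \<open>The array listing all \<open>k\<close>-tuples works. Existence is what ensures that the
  \<open>LEAST\<close> in \<open>LAN\<close> is attained by an actual array.\<close>

lemma full_factorial_locating_array:
  fixes V :: "nat \<Rightarrow> 'a set"
  assumes fin: "\<And>j. j \<in> {1..k} \<Longrightarrow> finite (V j)" and two: "\<And>j. j \<in> {1..k} \<Longrightarrow> 2 \<le> card (V j)"
  shows "\<exists>N A. N > 0 \<and> locating_array t N k V A"
proof -
  define F where "F = PiE {1..k} V"
  have "finite F" unfolding F_def using fin by (intro finite_PiE) auto
  have ne: "V j \<noteq> {}" if "j \<in> {1..k}" for j using two[OF that] by auto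
  then have "F \<noteq> {}" unfolding F_def by (simp add: PiE_eq_empty_iff)
  obtain A where bij: "bij_betw A {1..card F} F"
    using ex_bij_betw_nat_finite_1[OF \<open>finite F\<close>] by blast
  have arr: "is_array (card F) k V A"
    using bij unfolding is_array_def F_def by (auto dest!: bij_betwE)
  define R where "R = rho (card F) A"
  have row: "\<exists>r \<in> R (interaction J \<sigma>). A r = f"
    if "f \<in> F" "\<forall>j\<in>J. f j = \<sigma> j" for f J \<sigma>
  proof -
    have "f \<in> A ` {1..card F}" using bij that(1) by (simp add: bij_betw_imp_surj_on)
    then obtain r where "r \<in> {1..card F}" "A r = f" by blast
    then show ?thesis using that(2) unfolding R_def rho_interaction by blast
  qed
  \<comment> \<open>The free choice of \<open>y\<close> in a column outside \<open>J\<close> is what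
    separates two interactions.\<close>
  have extend: "\<exists>f\<in>F. (\<forall>j\<in>J. f j = \<sigma> j) \<and> (m \<notin> J \<longrightarrow> f m = y)"
    if "\<And>j. j \<in> J \<Longrightarrow> \<sigma> j \<in> V j" "J \<subseteq> {1..k}" "m \<in> {1..k}" "y \<in> V m" for J \<sigma> m y
  proof -
    have "\<exists>x. x \<in> V j" if "j \<in> {1..k}" for j using ne[OF that] by auto
    then obtain g where "\<And>j. j \<in> {1..k} \<Longrightarrow> g j \<in> V j" by metis
    then have "(\<lambda>j\<in>{1..k}. if j \<in> J then \<sigma> j else if j = m then y else g j) \<in> F"
      using that unfolding F_def by auto
    then show ?thesis using that by (intro bexI) auto
  qed
  have nonempty: "R T \<noteq> {}" if T: "T \<in> interactions t k V" for T
  proof -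
    obtain J \<sigma> where J: "T = interaction J \<sigma>" "J \<subseteq> {1..k}" "\<And>j. j \<in> J \<Longrightarrow> \<sigma> j \<in> V j"
      using interactionE[OF T] by metis
    have "\<exists>f\<in>F. \<forall>j\<in>J. f j = \<sigma> j"
    \<comment> \<open>For nonempty \<open>J\<close>, a column \<open>m\<close> in \<open>J\<close>
      makes the clause about \<open>y\<close> vacuous.\<close>
    proof (cases "J = {}")
      case True then show ?thesis using \<open>F \<noteq> {}\<close> by auto
    next
      case False
      then obtain m where "m \<in> J" by blast
      then show ?thesis using extend[OF J(3) J(2), where m = m and y = "\<sigma> m"] J by blast
    qed
    then show ?thesis using row J(1) by blast
  qed
  \<comment> \<open>One inclusion suffices, the assumptions being symmetric in \<open>T\<close> and
    \<open>T'\<close>.\<close>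
  have sub: "T \<subseteq> T'"
    if T: "T \<in> interactions t k V" and T': "T' \<in> interactions t k V" and eq: "R T = R T'" for T T'
  proof -
    obtain J \<sigma> where J: "T = interaction J \<sigma>" "J \<subseteq> {1..k}" "\<And>j. j \<in> J \<Longrightarrow> \<sigma> j \<in> V j"
      using interactionE[OF T] by metis
    obtain K \<tau> where K: "T' = interaction K \<tau>" "K \<subseteq> {1..k}" "\<And>j. j \<in> K \<Longrightarrow> \<tau> j \<in> V j"
      using interactionE[OF T'] by metis
    have "m \<in> K \<and> \<tau> m = \<sigma> m" if m: "m \<in> J" for m
    proof -
      have mk: "m \<in> {1..k}" using m J by auto
      \<comment> \<open>A second symbol \<open>y\<close> exists in column \<open>m\<close>. If
        \<open>m\<close> were outside \<open>K\<close>, some row containing \<open>T'\<close> would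
        carry \<open>y\<close> there, although it must contain \<open>T\<close> as well.\<close>
      have "\<not> V m \<subseteq> {\<sigma> m}"
        using two[OF mk] card_mono[of "{\<sigma> m}" "V m"] by auto
      then obtain y where y: "y \<in> V m" "y \<noteq> \<sigma> m" by blast
      obtain f where f: "f \<in> F" "\<forall>j\<in>K. f j = \<tau> j" "m \<notin> K \<longrightarrow> f m = y"
        using extend[OF K(3) K(2) mk y(1)] by blast
      obtain r where "r \<in> R T'" "A r = f" using row[OF f(1,2)] K(1) by blast
      then have "f m = \<sigma> m" using eq m unfolding J(1) R_def rho_interaction by auto
      then show ?thesis using f y by auto
    qed
    then show ?thesis unfolding J(1) K(1) interaction_def by force
  qed
  have "inj_on R (interactions t k V)"
    by (rule inj_onI) (rule subset_antisym; rule sub; simp)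
  then have "locating_array t (card F) k V A"
    using arr nonempty unfolding locating_array_iff R_def by blast
  moreover have "card F > 0" using \<open>finite F\<close> \<open>F \<noteq> {}\<close> by (simp add: card_gt_0_iff)
  ultimately show ?thesis by blast
qed

section \<open>Lower bounds on the number of rows\<close>

text \<open>Each tuple over \<open>J\<close> is an interaction and hence occurs in a row, so
  restricting the rows to \<open>J\<close> reaches all of \<open>PiE J V\<close>.\<close>

lemma covering_bound:
  assumes L: "locating_array t N k V A" and J: "J \<subseteq> {1..k}" "card J = t"
  shows "(\<Prod>j\<in>J. card (V j)) \<le> N"
proof -
  have "finite J" using J finite_subset by blast
  have "PiE J V \<subseteq> (\<lambda>r. \<lambda>j\<in>J. A r j) ` {1..N}"
  proof
    fix \<sigma> assume \<sigma>: "\<sigma> \<in> PiE J V"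
    then have "interaction J \<sigma> \<in> interactions t k V" using J by (intro interactionI) auto
    then obtain r where r: "r \<in> rho N A (interaction J \<sigma>)"
      using rho_nonempty[OF L] by blast
    then have "\<sigma> = (\<lambda>j\<in>J. A r j)"
      using \<sigma> by (auto simp: rho_interaction PiE_def extensional_def fun_eq_iff)
    then show "\<sigma> \<in> (\<lambda>r. \<lambda>j\<in>J. A r j) ` {1..N}" using r by (auto simp: rho_interaction)
  qed
  then have "card (PiE J V) \<le> card {1..N}"
    by (meson card_image_le card_mono finite_atLeastAtMost finite_imageI le_trans)
  then show ?thesis using \<open>finite J\<close> by (simp add: card_PiE)
qed

text \<open>For each \<open>t\<close>-subset \<open>J\<close> of \<open>C\<close>, a row contains at
  most one interaction on \<open>J\<close>, namely its own restriction. The degree bound is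
  therefore \<open>card C choose t\<close>.\<close>

lemma incidence_bound:
  assumes L: "locating_array t N k V A" and C: "C \<subseteq> {1..k}"
    and fin: "\<And>j. j \<in> C \<Longrightarrow> finite (V j)"
  shows "2 * (\<Sum>J | J \<subseteq> C \<and> card J = t. \<Prod>j\<in>J. card (V j)) \<le> (1 + (card C choose t)) * N"
proof -
  define \<J> where "\<J> = {J. J \<subseteq> C \<and> card J = t}"
  define X where "X = (SIGMA J:\<J>. PiE J V)"
  define f where "f = (\<lambda>(J, \<sigma>). rho N A (interaction J \<sigma>))"
  have "finite C" using C finite_subset by blast
  then have "finite \<J>" and finJ: "\<And>J. J \<in> \<J> \<Longrightarrow> finite J"
    unfolding \<J>_def by (auto intro: finite_subset)
  have finP: "finite (PiE J V)" if "J \<in> \<J>" for J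
    by (rule finite_PiE[OF finJ[OF that] fin]) (use that in \<open>auto simp: \<J>_def\<close>)
  have int: "interaction J \<sigma> \<in> interactions t k V" if "(J, \<sigma>) \<in> X" for J \<sigma>
    using that C unfolding X_def \<J>_def by (intro interactionI) auto
  have inj: "inj_on f X"
  proof (rule inj_onI)
    fix x y assume xy: "x \<in> X" "y \<in> X" "f x = f y"
    obtain J \<sigma> K \<tau> where eq: "x = (J, \<sigma>)" "y = (K, \<tau>)" by (metis surj_pair)
    then have "interaction J \<sigma> = interaction K \<tau>"
      using xy int by (intro inj_onD[OF inj_rho[OF L]]) (auto simp: f_def)
    then have "J = K" "\<forall>j\<in>J. \<sigma> j = \<tau> j" by (auto simp: interaction_eq_iff)
    moreover have "\<sigma> \<in> PiE J V" "\<tau> \<in> PiE K V" using xy eq by (auto simp: X_def)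
    ultimately show "x = y" unfolding eq by (metis PiE_ext)
  qed
  have "2 * card X \<le> (1 + (card C choose t)) * card {1..N}"
  proof (rule double_count_distinct_nonempty[OF _ _ inj])
    show "finite X" unfolding X_def using \<open>finite \<J>\<close> finP by (intro finite_SigmaI)
    show "f x \<noteq> {}" if "x \<in> X" for x
      using rho_nonempty[OF L] int that by (cases x) (simp add: f_def)
    show "f x \<subseteq> {1..N}" for x by (cases x) (auto simp: f_def rho_def)
    fix r assume "r \<in> {1..N}"
    have "{x \<in> X. r \<in> f x} \<subseteq> (\<lambda>J. (J, \<lambda>j\<in>J. A r j)) ` \<J>"
    proof (clarify)
      fix J \<sigma> assume "(J, \<sigma>) \<in> X" "r \<in> f (J, \<sigma>)"
      then have "J \<in> \<J>" "\<sigma> = (\<lambda>j\<in>J. A r j)"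
        by (auto simp: X_def f_def rho_interaction PiE_def extensional_def fun_eq_iff)
      then show "(J, \<sigma>) \<in> (\<lambda>J. (J, \<lambda>j\<in>J. A r j)) ` \<J>" by blast
    qed
    then have "card {x \<in> X. r \<in> f x} \<le> card \<J>"
      using \<open>finite \<J>\<close> by (meson card_image_le card_mono finite_imageI le_trans)
    also have "card \<J> = card C choose t"
      unfolding \<J>_def by (rule n_subsets[OF \<open>finite C\<close>])
    finally show "card {x \<in> X. r \<in> f x} \<le> card C choose t" .
  qed simp
  moreover have "card X = (\<Sum>J\<in>\<J>. \<Prod>j\<in>J. card (V j))"
    unfolding X_def using \<open>finite \<J>\<close> finP finJ by (simp add: card_SigmaI card_PiE)
  ultimately show ?thesis by (simp add: \<J>_def)
qed

text \<open>The set \<open>K\<close> lacks one column to carry a \<open>t\<close>-way interaction. A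
  row contains at most one extension by column \<open>p\<close> and one by column \<open>q\<close>,
  so the counting lemma applies with degree bound 2.\<close>

lemma fibre_bound:
  assumes L: "locating_array t N k V A"
    and K: "K \<subseteq> {1..k}" "Suc (card K) = t" and \<sigma>: "\<And>j. j \<in> K \<Longrightarrow> \<sigma> j \<in> V j"
    and pq: "p \<in> {1..k}" "q \<in> {1..k}" "p \<notin> K" "q \<notin> K" "p \<noteq> q"
    and fin: "finite (V p)" "finite (V q)"
  shows "2 * (card (V p) + card (V q)) \<le> 3 * card (rho N A (interaction K \<sigma>))"
proof -
  define X where "X = (SIGMA j:{p, q}. V j)"
  define T where "T = (\<lambda>(j, y). interaction (insert j K) (\<sigma>(j := y)))"
  define f where "f = (\<lambda>x. rho N A (T x))"
  have "finite K" using K finite_subset by blast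
  have int: "T x \<in> interactions t k V" if "x \<in> X" for x
  proof -
    obtain j y where x: "x = (j, y)" by force
    then have "j \<in> {1..k}" "j \<notin> K" "y \<in> V j" using that pq by (auto simp: X_def)
    then show ?thesis
      unfolding T_def x prod.case using K \<sigma> \<open>finite K\<close> by (intro interactionI) auto
  qed
  \<comment> \<open>Since \<open>p\<close> and \<open>q\<close> are distinct and outside
    \<open>K\<close>, the column set reveals the added column, and the symbol there reveals
    \<open>y\<close>.\<close>
  have injT: "inj_on T X"
    using pq by (auto simp: inj_on_def X_def T_def interaction_eq_iff)
  have inj: "inj_on f X"
    using inj_onD[OF inj_rho[OF L]] inj_onD[OF injT] int
    unfolding f_def by (intro inj_onI) metis
  have "2 * card X \<le> (1 + 2) * card (rho N A (interaction K \<sigma>))"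
  proof (rule double_count_distinct_nonempty[OF _ _ inj])
    show "finite X" unfolding X_def using fin by auto
    show "finite (rho N A (interaction K \<sigma>))" by (simp add: rho_def)
    show "f x \<noteq> {}" if "x \<in> X" for x
      using rho_nonempty[OF L int[OF that]] by (simp add: f_def)
    show "f x \<subseteq> rho N A (interaction K \<sigma>)" if "x \<in> X" for x
      using that pq by (auto simp: X_def f_def T_def rho_interaction split: if_splits)
    fix r
    have "{x \<in> X. r \<in> f x} \<subseteq> {(p, A r p), (q, A r q)}"
      by (auto simp: X_def f_def T_def rho_interaction)
    then show "card {x \<in> X. r \<in> f x} \<le> 2"
      using card_mono[of "{(p, A r p), (q, A r q)}" "{x \<in> X. r \<in> f x}"] pq
      by (simp add: numeral_2_eq_2)
  qed
  moreover have "card X = card (V p) + card (V q)"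
    unfolding X_def using fin pq by (subst card_SigmaI) auto
  ultimately show ?thesis by simp
qed

text \<open>The sets of rows containing different choices of symbols on \<open>K\<close> are
  disjoint, so the bounds for the single choices add up.\<close>

lemma fibrewise_bound:
  assumes L: "locating_array t N k V A"
    and K: "K \<subseteq> {1..k}" "Suc (card K) = t"
    and pq: "p \<in> {1..k}" "q \<in> {1..k}" "p \<notin> K" "q \<notin> K" "p \<noteq> q"
    and fin: "\<And>j. j \<in> {1..k} \<Longrightarrow> finite (V j)"
    and less: "card (V q) < 2 * card (V p)"
  shows "(card (V q) + 1) * (\<Prod>j\<in>K. card (V j)) \<le> N"
proof -
  have "finite K" using K finite_subset by blast
  define R where "R = (\<lambda>\<sigma>. rho N A (interaction K \<sigma>))"
  have finP: "finite (PiE K V)" using \<open>finite K\<close> fin K by (intro finite_PiE) auto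
  \<comment> \<open>By \<open>less\<close>, twice the sum of the two alphabet sizes exceeds
    \<open>3 * card (V q)\<close>; integrality supplies the extra 1.\<close>
  have "card (V q) + 1 \<le> card (R \<sigma>)" if "\<sigma> \<in> PiE K V" for \<sigma>
    using fibre_bound[OF L K _ pq, of \<sigma>] that fin pq less unfolding R_def by fastforce
  then have "(\<Sum>\<sigma>\<in>PiE K V. card (V q) + 1) \<le> (\<Sum>\<sigma>\<in>PiE K V. card (R \<sigma>))"
    by (rule sum_mono)
  also have "\<dots> = card (\<Union>\<sigma>\<in>PiE K V. R \<sigma>)"
  proof (rule card_UN_disjoint[symmetric, OF finP])
    show "\<forall>\<sigma>\<in>PiE K V. finite (R \<sigma>)" by (simp add: R_def rho_def)
    show "\<forall>\<sigma>\<in>PiE K V. \<forall>\<tau>\<in>PiE K V. \<sigma> \<noteq> \<tau> \<longrightarrow> R \<sigma> \<inter> R \<tau> = {}"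
    proof (intro ballI impI)
      fix \<sigma> \<tau> assume "\<sigma> \<in> PiE K V" "\<tau> \<in> PiE K V" "\<sigma> \<noteq> \<tau>"
      then obtain j where "j \<in> K" "\<sigma> j \<noteq> \<tau> j" by (meson PiE_ext)
      then show "R \<sigma> \<inter> R \<tau> = {}" by (force simp: R_def rho_interaction)
    qed
  qed
  also have "\<dots> \<le> card {1..N}"
    by (rule card_mono) (auto simp: R_def rho_def)
  finally show ?thesis using \<open>finite K\<close> by (simp add: card_PiE mult.commute)
qed

section \<open>The four bounds on the locating array number\<close>

theorem theorem3p5:
  fixes t k :: nat and v :: "nat \<Rightarrow> nat" and V :: "nat \<Rightarrow> 'a set"
  assumes "0 < t" and "t < k"
    and "2 \<le> v 1" and "\<forall>i j. 1 \<le> i \<and> i \<le> j \<and> j \<le> k \<longrightarrow> v i \<le> v j"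
    and "\<forall>j\<in>{1..k}. finite (V j) \<and> card (V j) = v j"
  shows
    "(2 * v (k - t) \<le> v (k - t + 1) \<longrightarrow> (\<Prod>i=k-t+1..k. v i) \<le> LAN t k V) \<and>
     (\<forall>i\<in>{1..k-t}. (\<forall>j\<in>{i..k-t+1}. v j = v i) \<longrightarrow>
        \<lceil>2 * real (\<Sum>J | J \<subseteq> {i..k} \<and> card J = t. \<Prod>j\<in>J. v j)
           / (1 + real ((k - i + 1) choose t))\<rceil> \<le> int (LAN t k V)) \<and>
     (v (k - t) < v (k - t + 1) \<and> v (k - t + 1) < 2 * v (k - t) \<and> 2 \<le> t \<longrightarrow>
        max \<lceil>2 * real (\<Sum>J | J \<subseteq> {k-t..k} \<and> card J = t. \<Prod>j\<in>J. v j) / (real t + 2)\<rceil>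
            (int ((\<Prod>i=k-t+1..k. v i) + (\<Prod>i=k-t+2..k. v i))) \<le> int (LAN t k V)) \<and>
     (v (k - t) < v (k - t + 1) \<and> v (k - t + 1) < 2 * v (k - t) \<and> t = 1 \<longrightarrow>
        \<lceil>(2 * real (v (k - 1)) + 2 * real (v k)) / 3\<rceil> \<le> int (LAN t k V))"
proof -
  have fin: "\<And>j. j \<in> {1..k} \<Longrightarrow> finite (V j)" and card: "\<And>j. j \<in> {1..k} \<Longrightarrow> card (V j) = v j"
    using assms(5) by auto
  have "2 \<le> card (V j)" if "j \<in> {1..k}" for j
    using assms(3) assms(4)[rule_format, of 1 j] card[OF that] that by simp
  then have "\<exists>N A. N > 0 \<and> locating_array t N k V A"
    by (intro full_factorial_locating_array fin)
  then have "\<exists>A. locating_array t (LAN t k V) k V A"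
    using LeastI_ex[of "\<lambda>N. N > 0 \<and> (\<exists>A. locating_array t N k V A)"]
    unfolding LAN_def by blast
  then obtain A where L: "locating_array t (LAN t k V) k V A" by blast
  have prods: "(\<Prod>j\<in>J. card (V j)) = (\<Prod>j\<in>J. v j)" if "J \<subseteq> {1..k}" for J
    using that card by (intro prod.cong) auto
  \<comment> \<open>By monotonicity of \<open>v\<close>, the last \<open>t\<close> columns give the
    largest covering product.\<close>
  have one: "(\<Prod>i=k-t+1..k. v i) \<le> LAN t k V"
    using covering_bound[OF L, of "{k-t+1..k}"] assms(2) prods[of "{k-t+1..k}"] by simp
  have two: "\<lceil>2 * real (\<Sum>J | J \<subseteq> {i..k} \<and> card J = t. \<Prod>j\<in>J. v j)
      / (1 + real ((k - i + 1) choose t))\<rceil> \<le> int (LAN t k V)" if i: "i \<in> {1..k-t}" for i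
  proof -
    have C: "{i..k} \<subseteq> {1..k}" using i by auto
    have "card {i..k} = k - i + 1" using i by auto
    moreover have "(\<Sum>J | J \<subseteq> {i..k} \<and> card J = t. \<Prod>j\<in>J. card (V j))
        = (\<Sum>J | J \<subseteq> {i..k} \<and> card J = t. \<Prod>j\<in>J. v j)"
      using C by (intro sum.cong prods) auto
    ultimately have "2 * (\<Sum>J | J \<subseteq> {i..k} \<and> card J = t. \<Prod>j\<in>J. v j)
        \<le> (1 + ((k - i + 1) choose t)) * LAN t k V"
      using incidence_bound[OF L C fin] C by (simp add: subset_iff)
    then have "real (2 * (\<Sum>J | J \<subseteq> {i..k} \<and> card J = t. \<Prod>j\<in>J. v j))
        \<le> real ((1 + ((k - i + 1) choose t)) * LAN t k V)"
      by (simp only: of_nat_le_iff)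
    then show ?thesis
      by (simp add: ceiling_le_iff pos_divide_le_eq algebra_simps del: of_nat_sum of_nat_prod)
  qed
  \<comment> \<open>For \<open>i = k - t\<close> there are \<open>t + 1\<close> columns, and
    \<open>t + 1\<close> choose \<open>t\<close> is \<open>t + 1\<close>; this gives the denominator
    \<open>t + 2\<close>.\<close>
  have kt: "k - t \<in> {1..k-t}" "k - (k - t) + 1 = t + 1" using assms by auto
  then have three: "\<lceil>2 * real (\<Sum>J | J \<subseteq> {k-t..k} \<and> card J = t. \<Prod>j\<in>J. v j) / (real t + 2)\<rceil>
      \<le> int (LAN t k V)"
    using two[OF kt(1)] by (simp add: add.commute del: of_nat_sum of_nat_prod)
  have prod_bound: "(\<Prod>i=k-t+1..k. v i) + (\<Prod>i=k-t+2..k. v i) \<le> LAN t k V"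
    if "v (k - t + 1) < 2 * v (k - t)"
  proof -
    \<comment> \<open>Here \<open>p = k - t\<close>, \<open>q = k - t + 1\<close>, and
      \<open>K\<close> consists of the last \<open>t - 1\<close> columns (none if
      \<open>t = 1\<close>). Expanding the factor with \<open>+ 1\<close> produces the two
      products.\<close>
    have "(card (V (k-t+1)) + 1) * (\<Prod>j=k-t+2..k. card (V j)) \<le> LAN t k V"
      using assms that card by (intro fibrewise_bound[OF L, where p = "k - t"] fin) auto
    moreover have "(\<Prod>i=k-t+1..k. v i) = v (k-t+1) * (\<Prod>i=k-t+2..k. v i)"
      using assms by (subst prod.atLeast_Suc_atMost) auto
    ultimately show ?thesis
      using card[of "k-t+1"] prods[of "{k-t+2..k}"] assms by simp
  qed
  have four: "\<lceil>(2 * real (v (k - 1)) + 2 * real (v k)) / 3\<rceil> \<le> int (LAN t k V)" if "t = 1"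
  proof -
    \<comment> \<open>This is the preceding ceiling bound at \<open>t = 1\<close>: the column sets
      are two singletons, distinct because \<open>k\<close> is positive.\<close>
    have "{J. J \<subseteq> {k-1..k} \<and> card J = 1} = {{k-1}, {k}}"
      using assms that by (auto simp: card_1_singleton_iff)
    moreover have "k - 1 \<noteq> k" using assms by simp
    ultimately have "(\<Sum>J | J \<subseteq> {k-1..k} \<and> card J = 1. \<Prod>j\<in>J. v j) = v (k-1) + v k"
      by simp
    then show ?thesis using three that by (simp add: algebra_simps)
  qed
  from one two three prod_bound four show ?thesis
    by (simp only: max.bounded_iff of_nat_le_iff) blast
qed

end
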